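(* Let $K$ be an infinite field, $R=K[x,y,z]$, and $I=(x^a,y^b,z^c,x^\alpha y^\beta z^\gamma)$, where $0\le\alpha<a$, $0\le\beta<b$, $0\le\gamma<c$ are integers and at most one of $\alpha,\beta,\gamma$ is zero. Suppose $a+b+c+\alpha+\beta+\gamma\equiv 0\pmod 3$, put $s=\frac13(a+b+c+\alpha+\beta+\gamma)-2$, $A=s+2-a$, $B=s+2-b$, $C=s+2-c$, $M=s+2-(\alpha+\beta+\gamma)$, and assume $0\le M$, $0\le A\le\beta+\gamma$, $0\le B\le\alpha+\gamma$, $0\le C\le\alpha+\beta$. Then $R/I$ has the weak Lefschetz property if and only if the multiplication map $\times(x+y+z):[R/I]_s\to[R/I]_{s+1}$ is injective; equivalently, if and only if this map is surjective.
   Context: $R$ is standard graded and $[R/I]_d$ is the degree $d$ component. An artinian standard graded $K$-algebra $Q$ has the weak Lefschetz property if there is a linear form $\ell\in[Q]_1$ such that for all integers $d$ the map $\times\ell:[Q]_d\to[Q]_{d+1}$ has maximal rank, i.e. is injective or surjective. *)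

theory Defs
  imports
    "HOL-Library.Poly_Mapping"
    "HOL-Algebra.QuotRing"
    "HOL-Algebra.Algebraic_Closure_Type"
begin

text \<open>The polynomial ring over 'k in the variables 'v, as the monoid algebra of the free
  commutative monoid of monomials (finitely supported exponent vectors).\<close>

type_synonym ('v, 'k) mpoly = "('v \<Rightarrow>\<^sub>0 nat) \<Rightarrow>\<^sub>0 'k"

datatype xyz = Vx | Vy | Vz

definition Var :: "'v \<Rightarrow> ('v, 'k::comm_ring_1) mpoly" where
  "Var v = Poly_Mapping.single (Poly_Mapping.single v 1) 1"

abbreviation mpoly_ring :: "('v, 'k::comm_ring_1) mpoly ring" where
  "mpoly_ring \<equiv> ring_of_type_algebra"

definition monom_degree :: "('v \<Rightarrow>\<^sub>0 nat) \<Rightarrow> nat" where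
  "monom_degree m = (\<Sum>v\<in>Poly_Mapping.keys m. Poly_Mapping.lookup m v)"

text \<open>Degrees are integers; for \<open>d < 0\<close> the component is \<open>{0}\<close>.\<close>

definition homogeneous_component :: "int \<Rightarrow> ('v, 'k::comm_ring_1) mpoly set" where
  "homogeneous_component d = {f. \<forall>m\<in>Poly_Mapping.keys f. int (monom_degree m) = d}"

text \<open>For a homogeneous ideal \<open>I\<close> of the polynomial ring \<open>R\<close>, the component \<open>[R/I]\<^sub>d\<close> consists of
  the residue classes of the forms of degree \<open>d\<close>.\<close>

definition quotient_component :: "('v, 'k::comm_ring_1) mpoly set \<Rightarrow> int \<Rightarrow> ('v, 'k) mpoly set set" where
  "quotient_component I d = (\<lambda>f. I +>\<^bsub>mpoly_ring\<^esub> f) ` homogeneous_component d"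

definition mult_injective ::
  "('v, 'k::comm_ring_1) mpoly set \<Rightarrow> ('v, 'k) mpoly set \<Rightarrow> int \<Rightarrow> bool" where
  "mult_injective I l d \<longleftrightarrow>
     inj_on (\<lambda>q. l \<otimes>\<^bsub>mpoly_ring Quot I\<^esub> q) (quotient_component I d)"

definition mult_surjective ::
  "('v, 'k::comm_ring_1) mpoly set \<Rightarrow> ('v, 'k) mpoly set \<Rightarrow> int \<Rightarrow> bool" where
  "mult_surjective I l d \<longleftrightarrow>
     (\<lambda>q. l \<otimes>\<^bsub>mpoly_ring Quot I\<^esub> q) ` quotient_component I d = quotient_component I (d + 1)"

text \<open>The weak Lefschetz property of \<open>R/I\<close>. The notion is meant for homogeneous ideals \<open>I\<close> with
  \<open>R/I\<close> artinian, which is the case as soon as \<open>I\<close> is generated by homogeneous polynomials and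
  contains a power of each of the finitely many variables.\<close>

definition weak_Lefschetz :: "('v, 'k::field) mpoly set \<Rightarrow> bool" where
  "weak_Lefschetz I \<longleftrightarrow>
     (\<exists>l\<in>quotient_component I 1. \<forall>d::int. mult_injective I l d \<or> mult_surjective I l d)"

end

theory Submission
  imports Defs "Jordan_Normal_Form.Determinant"
begin

text \<open>
  Let \<open>J\<close> be the set of monomials in \<open>I\<close>. The monomials outside \<open>J\<close> of degree \<open>d\<close>, the standard
  ones, form a basis of \<open>[R/I]\<^sub>d\<close>, so multiplication by a linear form from degree \<open>d\<close> to degree
  \<open>d + 1\<close> is a matrix indexed by standard monomials. The degree \<open>s\<close> is one where this matrix is
  square, and the theorem says that this single matrix, for the form \<open>x + y + z\<close>, decides the weak
  Lefschetz property. Four facts carry the proof.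

  \<^enum> The matrix in degree \<open>s\<close> is square (\<open>card_std_monomials_aci\<close>). The assumptions on \<open>A\<close>, \<open>B\<close>, \<open>C\<close>,
    \<open>M\<close> force the least common multiple of any two generators to have degree at least \<open>s + 2\<close>. Hence in
    degrees \<open>s\<close> and \<open>s + 1\<close> the multiples of the four generators are disjoint, and the Hilbert function
    grows from \<open>s\<close> to \<open>s + 1\<close> by \<open>(s + 2) - A - B - C - M = 0\<close>. So injectivity and surjectivity in
    degree \<open>s\<close> coincide, both meaning that a determinant does not vanish.

  \<^enum> Bijectivity in degree \<open>s\<close> for some linear form \<open>L\<close> implies it for \<open>x + y + z\<close>
    (\<open>inj_mod_sum_of_variables\<close>). Along the pencil \<open>L + t (x + y + z)\<close> the determinant is a polynomial
    in \<open>t\<close> that is nonzero at \<open>t = 0\<close>; over an infinite field some \<open>t\<close> avoids its roots and also makes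
    all three coefficients of the form nonzero. A form with nonzero coefficients becomes
    \<open>x + y + z\<close> after rescaling the variables, and rescaling preserves monomial ideals.

  \<^enum> Surjectivity passes to higher degrees because \<open>R\<close> is generated in degree one (\<open>surj_mod_Suc\<close>).

  \<^enum> Injectivity passes from degree \<open>s\<close> to lower degrees because no socle element has degree below
    \<open>s\<close>: every standard monomial of degree at most \<open>s\<close> divides one of degree exactly \<open>s\<close>
    (\<open>aci_standard_extends\<close>, used through \<open>inj_mod_lower_degree\<close>).
\<close>

section \<open>Monomials and forms\<close>

lemma poly_mapping_sum_singles:
  "f = (\<Sum>m\<in>Poly_Mapping.keys f. Poly_Mapping.single m (Poly_Mapping.lookup f m))"
proof (rule poly_mapping_eqI)
  fix k
  show "Poly_Mapping.lookup f k =
    Poly_Mapping.lookup (\<Sum>m\<in>Poly_Mapping.keys f. Poly_Mapping.single m (Poly_Mapping.lookup f m)) k"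
    by (simp add: lookup_sum lookup_single when_def in_keys_iff)
qed

lemma lookup_times_single:
  fixes f :: "('v, 'k::comm_ring_1) mpoly"
  shows "Poly_Mapping.lookup (f * Poly_Mapping.single n c) (m + n) = Poly_Mapping.lookup f m * c"
proof -
  have "f * Poly_Mapping.single n c =
      (\<Sum>k\<in>Poly_Mapping.keys f. Poly_Mapping.single (k + n) (Poly_Mapping.lookup f k * c))"
    by (subst poly_mapping_sum_singles[of f]) (simp add: sum_distrib_right mult_single)
  then show ?thesis
    by (simp add: lookup_sum lookup_single when_def in_keys_iff)
qed

lemma lookup_times_single_not_multiple:
  fixes f :: "('v, 'k::comm_ring_1) mpoly"
  assumes "\<nexists>m. r = m + n"
  shows "Poly_Mapping.lookup (f * Poly_Mapping.single n c) r = 0"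
proof -
  have "f * Poly_Mapping.single n c =
      (\<Sum>k\<in>Poly_Mapping.keys f. Poly_Mapping.single (k + n) (Poly_Mapping.lookup f k * c))"
    by (subst poly_mapping_sum_singles[of f]) (simp add: sum_distrib_right mult_single)
  then show ?thesis using assms
    by (auto simp: lookup_sum lookup_single when_def in_keys_iff intro!: sum.neutral)
qed

lemma monom_degree_superset:
  assumes "finite S" "Poly_Mapping.keys m \<subseteq> S"
  shows "monom_degree m = (\<Sum>v\<in>S. Poly_Mapping.lookup m v)"
  unfolding monom_degree_def using assms
  by (intro sum.mono_neutral_left) (auto simp: in_keys_iff)

lemma monom_degree_add: "monom_degree (m + n) = monom_degree m + monom_degree n"
  using monom_degree_superset[of "Poly_Mapping.keys m \<union> Poly_Mapping.keys n"] keys_add[of m n]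
  by (simp add: lookup_add sum.distrib)

lemma monom_degree_single [simp]: "monom_degree (Poly_Mapping.single v i) = i"
  by (simp add: monom_degree_def)

lemma monom_degree_eq_0: "monom_degree m = 0 \<longleftrightarrow> m = 0"
proof
  assume "monom_degree m = 0"
  then have "Poly_Mapping.lookup m v = 0" for v
    by (cases "v \<in> Poly_Mapping.keys m") (auto simp: monom_degree_def in_keys_iff)
  then show "m = 0" by (intro poly_mapping_eqI) simp
qed (simp add: monom_degree_def)

text \<open>The form in which it is used below that the polynomial ring is standard graded.\<close>

lemma monomial_factor_variable:
  assumes "monom_degree m > 0"
  obtains v m' where "m = Poly_Mapping.single v 1 + m'" "monom_degree m = Suc (monom_degree m')"
proof -
  obtain v where v: "Poly_Mapping.lookup m v \<noteq> 0"
    using assms monom_degree_eq_0[of m] by (metis lookup_zero poly_mapping_eqI not_less_zero)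
  have "m = Poly_Mapping.single v 1 + (m - Poly_Mapping.single v 1)"
    using v by (intro poly_mapping_eqI) (auto simp: lookup_add lookup_minus lookup_single when_def)
  then show ?thesis using that monom_degree_add monom_degree_single
    by (metis plus_1_eq_Suc)
qed

lemma monom_degree_eq_1:
  assumes "monom_degree m = 1"
  obtains v where "m = Poly_Mapping.single v 1"
proof -
  obtain v m' where "m = Poly_Mapping.single v 1 + m'" "monom_degree m = Suc (monom_degree m')"
    using monomial_factor_variable[of m] assms by auto
  then show ?thesis using that assms monom_degree_eq_0[of m'] by simp
qed

lemma times_homogeneous:
  assumes "f \<in> homogeneous_component d" "g \<in> homogeneous_component e"
  shows "f * g \<in> homogeneous_component (d + e)"
  using assms keys_mult[of f g] by (fastforce simp: homogeneous_component_def monom_degree_add)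

lemma diff_homogeneous:
  assumes "f \<in> homogeneous_component d" "g \<in> homogeneous_component d"
  shows "f - g \<in> homogeneous_component d"
  using assms keys_diff[of f g] by (fastforce simp: homogeneous_component_def)

lemma add_homogeneous:
  assumes "f \<in> homogeneous_component d" "g \<in> homogeneous_component d"
  shows "f + g \<in> homogeneous_component d"
  using assms keys_add[of f g] by (fastforce simp: homogeneous_component_def)

lemma zero_homogeneous: "0 \<in> homogeneous_component d"
  by (simp add: homogeneous_component_def)

lemma single_homogeneous: "Poly_Mapping.single m c \<in> homogeneous_component (int (monom_degree m))"
  by (simp add: homogeneous_component_def)

lemma sum_homogeneous:
  assumes "\<And>x. x \<in> S \<Longrightarrow> f x \<in> homogeneous_component d"
  shows "(\<Sum>x\<in>S. f x) \<in> homogeneous_component d"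
  using assms by (induction S rule: infinite_finite_induct) (auto simp: zero_homogeneous add_homogeneous)

section \<open>Monomial ideals\<close>

definition upclosed :: "('v \<Rightarrow>\<^sub>0 nat) set \<Rightarrow> bool" where
  "upclosed J \<longleftrightarrow> (\<forall>m\<in>J. \<forall>n. m + n \<in> J)"

text \<open>A monomial ideal is given by the set of its monomials; it is an ideal as soon as
  this set is closed under multiplication by monomials. Membership is then a condition on supports,
  which is what turns questions about residue classes into questions about coefficients.\<close>

definition monomial_ideal :: "('v \<Rightarrow>\<^sub>0 nat) set \<Rightarrow> ('v, 'k::comm_ring_1) mpoly set" where
  "monomial_ideal J = {f. Poly_Mapping.keys f \<subseteq> J}"

lemma mpoly_ring_simps [simp]:
  "carrier mpoly_ring = UNIV"
  "x \<otimes>\<^bsub>mpoly_ring\<^esub> y = x * y" "x \<oplus>\<^bsub>mpoly_ring\<^esub> y = x + y"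
  "\<zero>\<^bsub>mpoly_ring\<^esub> = 0" "\<one>\<^bsub>mpoly_ring\<^esub> = 1"
  by (simp_all add: ring_of_type_algebra_def)

lemma a_inv_mpoly_ring [simp]: "\<ominus>\<^bsub>mpoly_ring\<^esub> (x :: ('v, 'k::comm_ring_1) mpoly) = - x"
proof -
  interpret cring "mpoly_ring :: ('v, 'k) mpoly ring" by (rule cring_from_type_algebra)
  show ?thesis
    by (rule minus_equality) simp_all
qed

lemma a_minus_mpoly_ring [simp]: "x \<ominus>\<^bsub>mpoly_ring\<^esub> y = x - (y :: ('v, 'k::comm_ring_1) mpoly)"
  by (simp add: a_minus_def)

lemma monomial_ideal_add:
  "f \<in> monomial_ideal J \<Longrightarrow> g \<in> monomial_ideal J \<Longrightarrow> f + g \<in> monomial_ideal J"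
  using keys_add[of f g] by (auto simp: monomial_ideal_def)

lemma monomial_ideal_times:
  assumes "upclosed J" "f \<in> monomial_ideal J"
  shows "g * f \<in> monomial_ideal J"
proof -
  have "k + n \<in> J" if "n \<in> Poly_Mapping.keys f" for k n
    using that assms by (auto simp: monomial_ideal_def upclosed_def add.commute[of k])
  then show ?thesis
    using keys_mult[of g f] by (auto simp: monomial_ideal_def)
qed

lemma ideal_monomial_ideal:
  assumes "upclosed J"
  shows "ideal (monomial_ideal J) (mpoly_ring :: ('v, 'k::comm_ring_1) mpoly ring)"
proof -
  interpret cring "mpoly_ring :: ('v, 'k) mpoly ring" by (rule cring_from_type_algebra)
  show ?thesis
  proof (rule idealI)
    show "subgroup (monomial_ideal J) (add_monoid (mpoly_ring :: ('v, 'k) mpoly ring))"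
    proof
      fix x :: "('v, 'k) mpoly" assume "x \<in> monomial_ideal J"
      then show "inv\<^bsub>add_monoid mpoly_ring\<^esub> x \<in> monomial_ideal J"
        using a_inv_mpoly_ring[of x]
        by (simp add: a_inv_def monomial_ideal_def in_keys_iff subset_iff)
    qed (auto simp: monomial_ideal_add, auto simp: monomial_ideal_def)
    show "x \<otimes>\<^bsub>mpoly_ring\<^esub> a \<in> monomial_ideal J" if "a \<in> monomial_ideal J" for a x :: "('v, 'k) mpoly"
      using monomial_ideal_times[OF assms that] by simp
    then show "a \<otimes>\<^bsub>mpoly_ring\<^esub> x \<in> monomial_ideal J" if "a \<in> monomial_ideal J" for a x :: "('v, 'k) mpoly"
      using that by (simp add: mult.commute[of a x])
  qed (rule ring_axioms)
qed

definition multiples :: "('v \<Rightarrow>\<^sub>0 nat) set \<Rightarrow> ('v \<Rightarrow>\<^sub>0 nat) set" where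
  "multiples G = {g + n |g n. g \<in> G}"

lemma upclosed_multiples: "upclosed (multiples G)"
  unfolding upclosed_def multiples_def by (auto simp: add.assoc) (metis add.assoc)

text \<open>A polynomial supported on multiples of generators is a sum of terms that lie in
  the ideal one by one; the converse inclusion is minimality of the generated ideal.\<close>

lemma genideal_monomials:
  "Idl\<^bsub>mpoly_ring\<^esub> ((\<lambda>g. Poly_Mapping.single g 1) ` G) =
     (monomial_ideal (multiples G) :: ('v, 'k::comm_ring_1) mpoly set)" (is "Idl\<^bsub>_\<^esub> ?S = _")
proof
  interpret cring "mpoly_ring :: ('v, 'k) mpoly ring" by (rule cring_from_type_algebra)
  have id: "ideal (Idl\<^bsub>mpoly_ring\<^esub> ?S) mpoly_ring"
    by (rule genideal_ideal) simp
  then interpret Id: ideal "Idl\<^bsub>mpoly_ring\<^esub> ?S" "mpoly_ring :: ('v, 'k) mpoly ring" .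
  have S: "?S \<subseteq> Idl\<^bsub>mpoly_ring\<^esub> ?S" by (rule genideal_self) simp
  show "Idl\<^bsub>mpoly_ring\<^esub> ?S \<subseteq> monomial_ideal (multiples G)"
  proof (rule genideal_minimal[OF ideal_monomial_ideal[OF upclosed_multiples]])
    have "\<And>g. g \<in> G \<Longrightarrow> g \<in> multiples G"
      unfolding multiples_def mem_Collect_eq by (metis add.right_neutral)
    then show "?S \<subseteq> monomial_ideal (multiples G)"
      by (auto simp: monomial_ideal_def)
  qed
  show "monomial_ideal (multiples G) \<subseteq> Idl\<^bsub>mpoly_ring\<^esub> ?S"
  proof
    fix f :: "('v, 'k) mpoly" assume f: "f \<in> monomial_ideal (multiples G)"
    have single_mem: "Poly_Mapping.single m c \<in> Idl\<^bsub>mpoly_ring\<^esub> ?S" if "m \<in> multiples G" for m and c :: 'k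
    proof -
      obtain g n where gn: "m = g + n" "g \<in> G" using \<open>m \<in> multiples G\<close> by (auto simp: multiples_def)
      then have "Poly_Mapping.single g (1::'k) \<in> Idl\<^bsub>mpoly_ring\<^esub> ?S"
        using S by auto
      from Id.I_r_closed[OF this, of "Poly_Mapping.single n c"]
      show ?thesis by (simp add: mult_single gn)
    qed
    have sum_mem: "(\<Sum>m\<in>T. h m) \<in> Idl\<^bsub>mpoly_ring\<^esub> ?S"
      if "\<And>m. m \<in> T \<Longrightarrow> h m \<in> Idl\<^bsub>mpoly_ring\<^esub> ?S"
      for T :: "('v \<Rightarrow>\<^sub>0 nat) set" and h :: "_ \<Rightarrow> ('v, 'k) mpoly"
      using that Id.zero_closed Id.a_closed
      by (induction T rule: infinite_finite_induct) auto
    have "(\<Sum>m\<in>Poly_Mapping.keys f. Poly_Mapping.single m (Poly_Mapping.lookup f m))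
        \<in> Idl\<^bsub>mpoly_ring\<^esub> ?S"
      by (rule sum_mem, rule single_mem) (use f in \<open>auto simp: monomial_ideal_def\<close>)
    then show "f \<in> Idl\<^bsub>mpoly_ring\<^esub> ?S"
      using poly_mapping_sum_singles[of f] by simp
  qed
qed

section \<open>Multiplication on residue classes\<close>

text \<open>The maps in the theorem act on cosets of \<open>I\<close>. The next two predicates express
  injectivity and surjectivity of multiplication by \<open>L\<close> in degree \<open>d\<close> through representatives.\<close>

definition inj_mod :: "('v \<Rightarrow>\<^sub>0 nat) set \<Rightarrow> ('v, 'k::comm_ring_1) mpoly \<Rightarrow> int \<Rightarrow> bool" where
  "inj_mod J L d \<longleftrightarrow>
     (\<forall>f\<in>homogeneous_component d. L * f \<in> monomial_ideal J \<longrightarrow> f \<in> monomial_ideal J)"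

definition surj_mod :: "('v \<Rightarrow>\<^sub>0 nat) set \<Rightarrow> ('v, 'k::comm_ring_1) mpoly \<Rightarrow> int \<Rightarrow> bool" where
  "surj_mod J L d \<longleftrightarrow>
     (\<forall>g\<in>homogeneous_component (d + 1). \<exists>f\<in>homogeneous_component d. L * f - g \<in> monomial_ideal J)"

context
  fixes J :: "('v \<Rightarrow>\<^sub>0 nat) set" and I :: "('v, 'k::comm_ring_1) mpoly set"
  assumes up: "upclosed J"
  defines "I \<equiv> monomial_ideal J"
begin

lemma coset_eq_iff:
  "I +>\<^bsub>mpoly_ring\<^esub> f = I +>\<^bsub>mpoly_ring\<^esub> g \<longleftrightarrow> f - g \<in> I"
proof -
  interpret cring "mpoly_ring :: ('v, 'k) mpoly ring" by (rule cring_from_type_algebra)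
  show ?thesis
    using quotient_eq_iff_same_a_r_cos[OF ideal_monomial_ideal[OF up], of f g] by (simp add: I_def)
qed

lemma coset_mult:
  "(I +>\<^bsub>mpoly_ring\<^esub> f) \<otimes>\<^bsub>mpoly_ring Quot I\<^esub> (I +>\<^bsub>mpoly_ring\<^esub> g) = I +>\<^bsub>mpoly_ring\<^esub> (f * g)"
proof -
  interpret ideal I "mpoly_ring :: ('v, 'k) mpoly ring"
    unfolding I_def by (rule ideal_monomial_ideal[OF up])
  show ?thesis
    using rcoset_mult_add[of f g] by (simp add: FactRing_def)
qed

lemma mult_injective_iff:
  "mult_injective I (I +>\<^bsub>mpoly_ring\<^esub> L) d \<longleftrightarrow> inj_mod J L d"
proof
  assume inj: "mult_injective I (I +>\<^bsub>mpoly_ring\<^esub> L) d"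
  show "inj_mod J L d"
    unfolding inj_mod_def
  proof (intro ballI impI)
    fix f :: "('v, 'k) mpoly" assume f: "f \<in> homogeneous_component d" "L * f \<in> monomial_ideal J"
    have "(I +>\<^bsub>mpoly_ring\<^esub> L) \<otimes>\<^bsub>mpoly_ring Quot I\<^esub> (I +>\<^bsub>mpoly_ring\<^esub> f) =
        (I +>\<^bsub>mpoly_ring\<^esub> L) \<otimes>\<^bsub>mpoly_ring Quot I\<^esub> (I +>\<^bsub>mpoly_ring\<^esub> 0)"
      unfolding coset_mult coset_eq_iff using f by (simp add: I_def)
    then have "I +>\<^bsub>mpoly_ring\<^esub> f = I +>\<^bsub>mpoly_ring\<^esub> 0"
      by (rule inj_onD[OF inj[unfolded mult_injective_def]])
        (auto simp: quotient_component_def f zero_homogeneous)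
    then have "f - 0 \<in> I" unfolding coset_eq_iff .
    then show "f \<in> monomial_ideal J" by (simp add: I_def)
  qed
next
  assume inj: "inj_mod J L d"
  show "mult_injective I (I +>\<^bsub>mpoly_ring\<^esub> L) d"
    unfolding mult_injective_def quotient_component_def
  proof (intro inj_onI, clarify)
    fix f g :: "('v, 'k) mpoly"
    assume fg: "f \<in> homogeneous_component d" "g \<in> homogeneous_component d"
    assume "(I +>\<^bsub>mpoly_ring\<^esub> L) \<otimes>\<^bsub>mpoly_ring Quot I\<^esub> (I +>\<^bsub>mpoly_ring\<^esub> f) =
        (I +>\<^bsub>mpoly_ring\<^esub> L) \<otimes>\<^bsub>mpoly_ring Quot I\<^esub> (I +>\<^bsub>mpoly_ring\<^esub> g)"
    then have "L * (f - g) \<in> I" unfolding coset_mult coset_eq_iff by (simp only: right_diff_distrib)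
    then have "f - g \<in> I"
      unfolding I_def by (rule inj[unfolded inj_mod_def, rule_format, OF diff_homogeneous[OF fg]])
    then show "I +>\<^bsub>mpoly_ring\<^esub> f = I +>\<^bsub>mpoly_ring\<^esub> g" unfolding coset_eq_iff .
  qed
qed

lemma mult_surjective_iff:
  assumes L: "L \<in> homogeneous_component 1"
  shows "mult_surjective I (I +>\<^bsub>mpoly_ring\<^esub> L) d \<longleftrightarrow> surj_mod J L d"
proof -
  let ?m = "\<lambda>q. (I +>\<^bsub>mpoly_ring\<^esub> L) \<otimes>\<^bsub>mpoly_ring Quot I\<^esub> q"
  have im: "(\<lambda>q. (I +>\<^bsub>mpoly_ring\<^esub> L) \<otimes>\<^bsub>mpoly_ring Quot I\<^esub> q) ` quotient_component I d = (\<lambda>f. I +>\<^bsub>mpoly_ring\<^esub> (L * f)) ` homogeneous_component d"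
    unfolding quotient_component_def by (simp add: image_image coset_mult)
  have "?m ` quotient_component I d \<subseteq> quotient_component I (d + 1)"
    unfolding im unfolding quotient_component_def
    using times_homogeneous[OF L, of _ d] by (auto simp: add.commute[of 1])
  then have "mult_surjective I (I +>\<^bsub>mpoly_ring\<^esub> L) d \<longleftrightarrow>
      quotient_component I (d + 1) \<subseteq> (\<lambda>f. I +>\<^bsub>mpoly_ring\<^esub> (L * f)) ` homogeneous_component d"
    unfolding mult_surjective_def im by blast
  also have "\<dots> \<longleftrightarrow> (\<forall>g\<in>homogeneous_component (d + 1).
      \<exists>f\<in>homogeneous_component d. I +>\<^bsub>mpoly_ring\<^esub> (L * f) = I +>\<^bsub>mpoly_ring\<^esub> g)"
    unfolding quotient_component_def by (fastforce simp: image_iff)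
  also have "\<dots> \<longleftrightarrow> surj_mod J L d"
    unfolding coset_eq_iff surj_mod_def by (simp add: I_def)
  finally show ?thesis .
qed

end

section \<open>Square linear systems\<close>

definition system_injective :: "'r set \<Rightarrow> 'c set \<Rightarrow> ('r \<Rightarrow> 'c \<Rightarrow> 'k::field) \<Rightarrow> bool" where
  "system_injective R C m \<longleftrightarrow>
     (\<forall>f. (\<forall>r\<in>R. (\<Sum>c\<in>C. m r c * f c) = 0) \<longrightarrow> (\<forall>c\<in>C. f c = 0))"

definition system_surjective :: "'r set \<Rightarrow> 'c set \<Rightarrow> ('r \<Rightarrow> 'c \<Rightarrow> 'k::field) \<Rightarrow> bool" where
  "system_surjective R C m \<longleftrightarrow> (\<forall>g. \<exists>f. \<forall>r\<in>R. (\<Sum>c\<in>C. m r c * f c) = g r)"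

text \<open>The nonvanishing determinant is matched with both properties. If the determinant
  vanishes, a kernel vector of the transpose is a linear relation between the rows; testing it against
  the unit vectors, which surjectivity puts in the image, shows that the relation is trivial.\<close>

lemma square_system_det:
  fixes m :: "'r \<Rightarrow> 'c \<Rightarrow> 'k::field"
  assumes e: "bij_betw e {0..<n} C" and e': "bij_betw e' {0..<n} R"
  defines "D \<equiv> det (mat n n (\<lambda>(i, j). m (e' i) (e j)))"
  shows "D \<noteq> 0 \<longleftrightarrow> system_injective R C m" and "D \<noteq> 0 \<longleftrightarrow> system_surjective R C m"
proof -
  define A where "A = mat n n (\<lambda>(i, j). m (e' i) (e j))"
  have A: "A \<in> carrier_mat n n" by (simp add: A_def)
  define inv_e where "inv_e = the_inv_into {0..<n} e"
  have C: "C = e ` {0..<n}" and R: "R = e' ` {0..<n}"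
    using e e' by (auto simp: bij_betw_def)
  have inv_e: "inv_e (e j) = j" if "j < n" for j
    using that e by (auto simp: inv_e_def bij_betw_def the_inv_into_f_f)
  have mult: "(A *\<^sub>v v) $ i = (\<Sum>c\<in>C. m (e' i) c * v $ inv_e c)"
    if "v \<in> carrier_vec n" "i < n" for v i
  proof -
    have "(A *\<^sub>v v) $ i = (\<Sum>j\<in>{0..<n}. m (e' i) (e j) * v $ j)"
      using that by (simp add: A_def scalar_prod_def)
    also have "\<dots> = (\<Sum>j\<in>{0..<n}. m (e' i) (e j) * v $ inv_e (e j))"
      by (intro sum.cong) (auto simp: inv_e)
    also have "\<dots> = (\<Sum>c\<in>C. m (e' i) c * v $ inv_e c)"
      by (rule sum.reindex_bij_betw[OF e])
    finally show ?thesis .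
  qed
  have det_inj: "D \<noteq> 0 \<longleftrightarrow> (\<forall>v\<in>carrier_vec n. A *\<^sub>v v = 0\<^sub>v n \<longrightarrow> v = 0\<^sub>v n)"
    using det_0_iff_vec_prod_zero_field[OF A] by (auto simp: D_def A_def)
  show "D \<noteq> 0 \<longleftrightarrow> system_injective R C m"
    unfolding det_inj system_injective_def
  proof (intro iffI allI impI ballI)
    fix f c assume *: "\<forall>v\<in>carrier_vec n. A *\<^sub>v v = 0\<^sub>v n \<longrightarrow> v = 0\<^sub>v n"
      and f: "\<forall>r\<in>R. (\<Sum>c\<in>C. m r c * f c) = 0" and c: "c \<in> C"
    define v where "v = vec n (\<lambda>j. f (e j))"
    have v: "v \<in> carrier_vec n" "\<And>c. c \<in> C \<Longrightarrow> v $ inv_e c = f c"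
      by (auto simp: v_def C inv_e)
    have "A *\<^sub>v v = 0\<^sub>v n"
    proof (rule eq_vecI)
      fix i assume "i < dim_vec (0\<^sub>v n :: 'k vec)"
      then have "i < n" by simp
      then have "e' i \<in> R" by (auto simp: R)
      then show "(A *\<^sub>v v) $ i = 0\<^sub>v n $ i"
        using mult[OF v(1) \<open>i < n\<close>] f v(2) \<open>i < n\<close> by simp
    qed (use A in auto)
    with * v(1) have "v = 0\<^sub>v n" by blast
    moreover obtain j where "j < n" "c = e j" using c by (auto simp: C)
    ultimately show "f c = 0"
      by (metis v_def index_vec index_zero_vec(1))
  next
    fix v
    assume inj: "\<forall>f. (\<forall>r\<in>R. (\<Sum>c\<in>C. m r c * f c) = 0) \<longrightarrow> (\<forall>c\<in>C. f c = 0)"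
      and v: "v \<in> carrier_vec n" "A *\<^sub>v v = 0\<^sub>v n"
    have "\<forall>r\<in>R. (\<Sum>c\<in>C. m r c * v $ inv_e c) = 0"
    proof
      fix r assume "r \<in> R"
      then obtain i where i: "i < n" "r = e' i" by (auto simp: R)
      then show "(\<Sum>c\<in>C. m r c * v $ inv_e c) = 0"
        using mult[OF v(1) i(1)] v(2) by simp
    qed
    with inj[rule_format, of "\<lambda>c. v $ inv_e c"] have "\<forall>c\<in>C. v $ inv_e c = 0" by blast
    then show "v = 0\<^sub>v n"
      using v(1) by (intro eq_vecI) (auto simp: C inv_e)
  qed
  show "D \<noteq> 0 \<longleftrightarrow> system_surjective R C m"
  proof
    assume "D \<noteq> 0"
    then have "A \<in> Units (ring_mat TYPE('k) n ())"
      using det_non_zero_imp_unit[OF A] by (simp add: D_def A_def)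
    then obtain B where B: "B \<in> carrier_mat n n" "A * B = 1\<^sub>m n"
      by (auto simp: Units_def ring_mat_def)
    show "system_surjective R C m"
      unfolding system_surjective_def
    proof
      fix g :: "'r \<Rightarrow> 'k"
      define w where "w = vec n (\<lambda>i. g (e' i))"
      have w: "w \<in> carrier_vec n" by (simp add: w_def)
      have Bw: "B *\<^sub>v w \<in> carrier_vec n" using B(1) w by simp
      have "A *\<^sub>v (B *\<^sub>v w) = w"
        using assoc_mult_mat_vec[OF A B(1) w] B(2) w by simp
      then have "\<forall>r\<in>R. (\<Sum>c\<in>C. m r c * (B *\<^sub>v w) $ inv_e c) = g r"
        using mult[OF Bw] by (auto simp: R w_def)
      then show "\<exists>f. \<forall>r\<in>R. (\<Sum>c\<in>C. m r c * f c) = g r"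
        by (intro exI[of _ "\<lambda>c. (B *\<^sub>v w) $ inv_e c"])
    qed
  next
    assume surj: "system_surjective R C m"
    show "D \<noteq> 0"
    proof
      assume "D = 0"
      then have "det (transpose_mat A) = 0"
        using det_transpose[OF A] by (simp add: D_def A_def)
      then obtain w where w: "w \<in> carrier_vec n" "w \<noteq> 0\<^sub>v n" "transpose_mat A *\<^sub>v w = 0\<^sub>v n"
        using det_0_iff_vec_prod_zero_field[of "transpose_mat A" n] A by auto
      have col: "(\<Sum>i\<in>{0..<n}. w $ i * m (e' i) c) = 0" if c: "c \<in> C" for c
      proof -
        obtain j where j: "j < n" "c = e j" using c by (auto simp: C)
        have "(transpose_mat A *\<^sub>v w) $ j = (\<Sum>i\<in>{0..<n}. m (e' i) c * w $ i)"
          using j w(1) by (simp add: A_def scalar_prod_def)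
        then show ?thesis using w(3) j by (simp add: mult.commute)
      qed
      have "w $ k = 0" if k: "k < n" for k
      proof -
        obtain f where f: "\<forall>r\<in>R. (\<Sum>c\<in>C. m r c * f c) = (if r = e' k then 1 else 0)"
          using surj[unfolded system_surjective_def, rule_format, of "\<lambda>r. if r = e' k then 1 else 0"] by blast
        have "0 = (\<Sum>c\<in>C. (\<Sum>i\<in>{0..<n}. w $ i * m (e' i) c) * f c)"
          by (simp add: col)
        also have "\<dots> = (\<Sum>i\<in>{0..<n}. w $ i * (\<Sum>c\<in>C. m (e' i) c * f c))"
          using sum.swap[of "\<lambda>c i. w $ i * m (e' i) c * f c" "{0..<n}" C]
          by (simp add: sum_distrib_left sum_distrib_right mult.assoc)
        also have "\<dots> = (\<Sum>i\<in>{0..<n}. w $ i * (if e' i = e' k then 1 else 0))"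
          using f by (intro sum.cong) (auto simp: R)
        also have "\<dots> = (\<Sum>i\<in>{0..<n}. if i = k then w $ i else 0)"
          using e' k by (intro sum.cong) (auto simp: bij_betw_def inj_on_def)
        also have "\<dots> = w $ k" using k by simp
        finally show ?thesis by simp
      qed
      then have "w = 0\<^sub>v n" using w(1) by (intro eq_vecI) auto
      with w(2) show False by simp
    qed
  qed
qed

text \<open>The polynomial is the determinant of the matrix with entries \<open>a + b X\<close>:
  evaluation at \<open>t\<close> is a ring homomorphism and commutes with the determinant. For \<open>b = 0\<close> the lemma says
  that injectivity and surjectivity of a square system agree; for general \<open>b\<close> it says that the
  singular members of a pencil are the zeros of one polynomial.\<close>

lemma square_pencil_polynomial:
  fixes a b :: "'r \<Rightarrow> 'c \<Rightarrow> 'k::field"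
  assumes "finite R" "finite C" "card R = card C"
  shows "\<exists>p :: 'k poly. \<forall>t.
    (poly p t \<noteq> 0 \<longleftrightarrow> system_injective R C (\<lambda>r c. a r c + t * b r c)) \<and>
    (poly p t \<noteq> 0 \<longleftrightarrow> system_surjective R C (\<lambda>r c. a r c + t * b r c))"
proof -
  define n where "n = card C"
  obtain e where e: "bij_betw e {0..<n} C"
    using ex_bij_betw_nat_finite[OF assms(2)] by (auto simp: n_def)
  obtain e' where e': "bij_betw e' {0..<n} R"
    using ex_bij_betw_nat_finite[OF assms(1)] assms(3) by (auto simp: n_def)
  define P where "P = mat n n (\<lambda>(i, j). [:a (e' i) (e j), b (e' i) (e j):])"
  have "poly (det P) t = det (mat n n (\<lambda>(i, j). a (e' i) (e j) + t * b (e' i) (e j)))" for t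
  proof -
    interpret comm_ring_hom "\<lambda>p. poly p t"
      by unfold_locales (simp_all add: poly_1)
    have "map_mat (\<lambda>p. poly p t) P = mat n n (\<lambda>(i, j). a (e' i) (e j) + t * b (e' i) (e j))"
      by (rule eq_matI) (auto simp: P_def)
    then show ?thesis by (metis hom_det)
  qed
  then show ?thesis
    using square_system_det[OF e e', of "\<lambda>r c. a r c + t * b r c" for t]
    by (intro exI[of _ "det P"] allI conjI) (simp_all only:)
qed

section \<open>The matrix of multiplication by a form\<close>

text \<open>For \<open>J = {}\<close> these are all monomials of degree \<open>d\<close>.\<close>

definition std_monomials :: "('v \<Rightarrow>\<^sub>0 nat) set \<Rightarrow> int \<Rightarrow> ('v \<Rightarrow>\<^sub>0 nat) set" where
  "std_monomials J d = {m. int (monom_degree m) = d \<and> m \<notin> J}"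

definition mult_entry :: "('v, 'k::comm_ring_1) mpoly \<Rightarrow> ('v \<Rightarrow>\<^sub>0 nat) \<Rightarrow> ('v \<Rightarrow>\<^sub>0 nat) \<Rightarrow> 'k" where
  "mult_entry L r c = Poly_Mapping.lookup (L * Poly_Mapping.single c 1) r"

lemma mult_entry_add [simp]: "mult_entry L (k + c) c = Poly_Mapping.lookup L k"
  by (simp add: mult_entry_def lookup_times_single)

lemma mult_entry_not_multiple: "\<nexists>k. r = k + c \<Longrightarrow> mult_entry L r c = 0"
  by (simp add: mult_entry_def lookup_times_single_not_multiple)

lemma lookup_times_single_mult_entry:
  "Poly_Mapping.lookup (L * Poly_Mapping.single c x) r = mult_entry L r c * x"
proof (cases "\<exists>k. r = k + c")
  case True
  then show ?thesis by (auto simp: lookup_times_single)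
next
  case False
  then show ?thesis by (simp add: lookup_times_single_not_multiple mult_entry_not_multiple)
qed

lemma lookup_times:
  assumes "finite S" "Poly_Mapping.keys f \<subseteq> S"
  shows "Poly_Mapping.lookup (L * f) r = (\<Sum>c\<in>S. mult_entry L r c * Poly_Mapping.lookup f c)"
proof -
  have "L * f = (\<Sum>c\<in>Poly_Mapping.keys f. L * Poly_Mapping.single c (Poly_Mapping.lookup f c))"
    by (subst poly_mapping_sum_singles[of f]) (simp add: sum_distrib_left)
  then have "Poly_Mapping.lookup (L * f) r =
      (\<Sum>c\<in>Poly_Mapping.keys f. mult_entry L r c * Poly_Mapping.lookup f c)"
    by (simp add: lookup_sum lookup_times_single_mult_entry)
  also have "\<dots> = (\<Sum>c\<in>S. mult_entry L r c * Poly_Mapping.lookup f c)"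
    using assms by (intro sum.mono_neutral_left) (auto simp: in_keys_iff)
  finally show ?thesis .
qed

text \<open>Multiplication by \<open>L\<close> maps the ideal into itself, so monomials of the
  ideal contribute nothing to the coefficients outside it. This lets the matrix descend to the
  quotient.\<close>

lemma mult_entry_ideal_column:
  assumes "upclosed J" "c \<in> J" "r \<notin> J"
  shows "mult_entry L r c = 0"
proof (rule mult_entry_not_multiple, rule notI)
  assume "\<exists>k. r = k + c"
  with assms show False by (auto simp: upclosed_def add.commute)
qed

lemma lookup_times_std_monomials:
  assumes up: "upclosed J" and fin: "finite (std_monomials J d)"
    and f: "f \<in> homogeneous_component d" and r: "r \<notin> J"
  shows "Poly_Mapping.lookup (L * f) r =
    (\<Sum>c\<in>std_monomials J d. mult_entry L r c * Poly_Mapping.lookup f c)"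
proof -
  have "Poly_Mapping.lookup (L * f) r =
      (\<Sum>c\<in>Poly_Mapping.keys f \<union> std_monomials J d. mult_entry L r c * Poly_Mapping.lookup f c)"
    using fin by (intro lookup_times) auto
  also have "\<dots> = (\<Sum>c\<in>std_monomials J d. mult_entry L r c * Poly_Mapping.lookup f c)"
  proof (rule sum.mono_neutral_right)
    show "\<forall>c\<in>Poly_Mapping.keys f \<union> std_monomials J d - std_monomials J d.
        mult_entry L r c * Poly_Mapping.lookup f c = 0"
      using f by (auto simp: homogeneous_component_def std_monomials_def mult_entry_ideal_column[OF up _ r])
  qed (use fin in auto)
  finally show ?thesis .
qed

lemma homogeneous_in_monomial_ideal_iff:
  assumes "h \<in> homogeneous_component e"
  shows "h \<in> monomial_ideal J \<longleftrightarrow> (\<forall>r\<in>std_monomials J e. Poly_Mapping.lookup h r = 0)"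
  using assms by (auto simp: monomial_ideal_def std_monomials_def homogeneous_component_def in_keys_iff)

definition poly_of :: "('v \<Rightarrow>\<^sub>0 nat) set \<Rightarrow> (('v \<Rightarrow>\<^sub>0 nat) \<Rightarrow> 'k) \<Rightarrow> ('v, 'k::comm_ring_1) mpoly" where
  "poly_of S f = (\<Sum>c\<in>S. Poly_Mapping.single c (f c))"

lemma lookup_poly_of:
  "finite S \<Longrightarrow> c \<in> S \<Longrightarrow> Poly_Mapping.lookup (poly_of S f) c = f c"
  by (simp add: poly_of_def lookup_sum lookup_single when_def)

lemma poly_of_homogeneous: "poly_of (std_monomials J d) f \<in> homogeneous_component d"
  unfolding poly_of_def
proof (rule sum_homogeneous)
  fix c assume "c \<in> std_monomials J d"
  then show "Poly_Mapping.single c (f c) \<in> homogeneous_component d"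
    using single_homogeneous[of c "f c"] by (simp add: std_monomials_def)
qed

text \<open>The standard monomials represent a basis of the quotient in each degree, so a
  form modulo \<open>I\<close> is an arbitrary coefficient function on them.\<close>

lemma inj_mod_iff_system:
  fixes L :: "('v, 'k::field) mpoly"
  assumes up: "upclosed J" and fin: "finite (std_monomials J d)" and L: "L \<in> homogeneous_component 1"
  shows "inj_mod J L d \<longleftrightarrow>
    system_injective (std_monomials J (d + 1)) (std_monomials J d) (mult_entry L)"
    (is "_ \<longleftrightarrow> ?sys")
proof -
  have mem: "L * f \<in> monomial_ideal J \<longleftrightarrow> (\<forall>r\<in>std_monomials J (d + 1).
      (\<Sum>c\<in>std_monomials J d. mult_entry L r c * Poly_Mapping.lookup f c) = 0)"
    if f: "f \<in> homogeneous_component d" for f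
  proof -
    have "L * f \<in> homogeneous_component (d + 1)"
      using times_homogeneous[OF L f] by (simp add: add.commute)
    note homogeneous_in_monomial_ideal_iff[OF this, of J]
    then show ?thesis
      using lookup_times_std_monomials[OF up fin f] by (simp add: std_monomials_def)
  qed
  show ?thesis
  proof
    assume inj: "inj_mod J L d"
    show ?sys
      unfolding system_injective_def
    proof (intro allI impI)
      fix f assume f: "\<forall>r\<in>std_monomials J (d + 1). (\<Sum>c\<in>std_monomials J d. mult_entry L r c * f c) = 0"
      let ?F = "poly_of (std_monomials J d) f"
      have "L * ?F \<in> monomial_ideal J"
        unfolding mem[OF poly_of_homogeneous] using f by (simp add: lookup_poly_of[OF fin])
      then have "?F \<in> monomial_ideal J"
        using inj poly_of_homogeneous unfolding inj_mod_def by blast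
      then show "\<forall>c\<in>std_monomials J d. f c = 0"
        unfolding homogeneous_in_monomial_ideal_iff[OF poly_of_homogeneous]
        by (simp add: lookup_poly_of[OF fin])
    qed
  next
    assume sys: ?sys
    show "inj_mod J L d"
      unfolding inj_mod_def
    proof (intro ballI impI)
      fix f assume f: "f \<in> homogeneous_component d" "L * f \<in> monomial_ideal J"
      then show "f \<in> monomial_ideal J"
        using sys[unfolded system_injective_def, rule_format, of "Poly_Mapping.lookup f"]
        unfolding mem[OF f(1)] homogeneous_in_monomial_ideal_iff[OF f(1)] by simp
    qed
  qed
qed

lemma surj_mod_iff_system:
  fixes L :: "('v, 'k::field) mpoly"
  assumes up: "upclosed J" and fin: "finite (std_monomials J d)" "finite (std_monomials J (d + 1))"
    and L: "L \<in> homogeneous_component 1"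
  shows "surj_mod J L d \<longleftrightarrow>
    system_surjective (std_monomials J (d + 1)) (std_monomials J d) (mult_entry L)"
    (is "_ \<longleftrightarrow> ?sys")
proof -
  have mem: "L * f - g \<in> monomial_ideal J \<longleftrightarrow> (\<forall>r\<in>std_monomials J (d + 1).
      (\<Sum>c\<in>std_monomials J d. mult_entry L r c * Poly_Mapping.lookup f c) = Poly_Mapping.lookup g r)"
    if f: "f \<in> homogeneous_component d" and g: "g \<in> homogeneous_component (d + 1)" for f g
  proof -
    have "L * f - g \<in> homogeneous_component (d + 1)"
      using times_homogeneous[OF L f] g by (simp add: add.commute diff_homogeneous)
    note homogeneous_in_monomial_ideal_iff[OF this, of J]
    then show ?thesis
      using lookup_times_std_monomials[OF up fin(1) f] by (simp add: std_monomials_def lookup_minus)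
  qed
  show ?thesis
  proof
    assume surj: "surj_mod J L d"
    show ?sys
      unfolding system_surjective_def
    proof
      fix g :: "('v \<Rightarrow>\<^sub>0 nat) \<Rightarrow> 'k"
      let ?G = "poly_of (std_monomials J (d + 1)) g"
      obtain f where f: "f \<in> homogeneous_component d" "L * f - ?G \<in> monomial_ideal J"
        using surj poly_of_homogeneous unfolding surj_mod_def by blast
      then have "\<forall>r\<in>std_monomials J (d + 1).
          (\<Sum>c\<in>std_monomials J d. mult_entry L r c * Poly_Mapping.lookup f c) = g r"
        unfolding mem[OF f(1) poly_of_homogeneous] by (simp add: lookup_poly_of[OF fin(2)])
      then show "\<exists>f. \<forall>r\<in>std_monomials J (d + 1).
          (\<Sum>c\<in>std_monomials J d. mult_entry L r c * f c) = g r"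
        by (intro exI[of _ "Poly_Mapping.lookup f"])
    qed
  next
    assume sys: ?sys
    show "surj_mod J L d"
      unfolding surj_mod_def
    proof
      fix g :: "('v, 'k) mpoly" assume g: "g \<in> homogeneous_component (d + 1)"
      obtain f where f: "\<forall>r\<in>std_monomials J (d + 1).
          (\<Sum>c\<in>std_monomials J d. mult_entry L r c * f c) = Poly_Mapping.lookup g r"
        using sys[unfolded system_surjective_def, rule_format, of "Poly_Mapping.lookup g"] by blast
      let ?F = "poly_of (std_monomials J d) f"
      have "L * ?F - g \<in> monomial_ideal J"
        unfolding mem[OF poly_of_homogeneous g] using f by (simp add: lookup_poly_of[OF fin(1)])
      then show "\<exists>f\<in>homogeneous_component d. L * f - g \<in> monomial_ideal J"
        using poly_of_homogeneous by blast
    qed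
  qed
qed

lemma mult_entry_pencil:
  "mult_entry (L + Poly_Mapping.single 0 t * L') r c = mult_entry L r c + t * mult_entry L' r c"
proof -
  have "Poly_Mapping.lookup (Poly_Mapping.single 0 t * f) r = t * Poly_Mapping.lookup f r" for f
    using lookup_times_single[of f 0 t r] by (simp add: mult.commute)
  then show ?thesis
    by (simp add: mult_entry_def distrib_right lookup_add mult.assoc)
qed

lemma inj_mod_iff_surj_mod:
  fixes L :: "('v, 'k::field) mpoly"
  assumes "upclosed J" "L \<in> homogeneous_component 1"
    and "finite (std_monomials J d)" "finite (std_monomials J (d + 1))"
    and "card (std_monomials J (d + 1)) = card (std_monomials J d)"
  shows "inj_mod J L d \<longleftrightarrow> surj_mod J L d"
proof -
  obtain p :: "'k poly" where p: "\<forall>t.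
    (poly p t \<noteq> 0 \<longleftrightarrow> system_injective (std_monomials J (d + 1)) (std_monomials J d)
       (\<lambda>r c. mult_entry L r c + t * 0)) \<and>
    (poly p t \<noteq> 0 \<longleftrightarrow> system_surjective (std_monomials J (d + 1)) (std_monomials J d)
       (\<lambda>r c. mult_entry L r c + t * 0))"
    using square_pencil_polynomial[OF assms(4,3,5), of "mult_entry L" "\<lambda>_ _. 0"] by blast
  show ?thesis
    unfolding inj_mod_iff_system[OF assms(1,3,2)] surj_mod_iff_system[OF assms(1,3,4,2)]
    using p[rule_format, of 0] by (simp, blast)
qed

section \<open>From an arbitrary linear form to the sum of the variables\<close>

text \<open>The value of the monomial \<open>m\<close> at the point \<open>u\<close>.\<close>

definition weight :: "('v::finite \<Rightarrow> 'k) \<Rightarrow> ('v \<Rightarrow>\<^sub>0 nat) \<Rightarrow> 'k::field" where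
  "weight u m = (\<Prod>v\<in>UNIV. u v ^ Poly_Mapping.lookup m v)"

lemma weight_add: "weight u (m + n) = weight u m * weight u n"
  by (simp add: weight_def lookup_add power_add prod.distrib)

lemma weight_nonzero: "(\<And>v. u v \<noteq> 0) \<Longrightarrow> weight u m \<noteq> 0"
  by (simp add: weight_def)

lemma weight_single: "weight u (Poly_Mapping.single v 1) = u v"
proof -
  have "weight u (Poly_Mapping.single v 1) = (\<Prod>w\<in>UNIV. if w = v then u w else 1)"
    unfolding weight_def by (intro prod.cong) (auto simp: lookup_single when_def)
  then show ?thesis by simp
qed

lemma lookup_Var_sum:
  "Poly_Mapping.lookup (\<Sum>v\<in>(UNIV :: 'v::finite set). Var v :: ('v, 'k::comm_ring_1) mpoly)
     (Poly_Mapping.single w 1) = 1"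
proof -
  have "Poly_Mapping.single v (1::nat) = Poly_Mapping.single w 1 \<longleftrightarrow> v = w" for v w :: 'v
    by (metis lookup_single_eq lookup_single_not_eq zero_neq_one)
  then show ?thesis
    by (simp only: lookup_sum Var_def lookup_single when_def) simp
qed

lemma Var_sum_homogeneous:
  "(\<Sum>v\<in>(UNIV :: 'v::finite set). Var v :: ('v, 'k::comm_ring_1) mpoly) \<in> homogeneous_component 1"
  by (intro sum_homogeneous) (simp add: Var_def homogeneous_component_def)

lemma linear_form_rescaled:
  fixes L :: "('v::finite, 'k::field) mpoly"
  assumes L: "L \<in> homogeneous_component 1"
  shows "Poly_Mapping.lookup L k =
    weight (\<lambda>v. Poly_Mapping.lookup L (Poly_Mapping.single v 1)) k * Poly_Mapping.lookup (\<Sum>v\<in>UNIV. Var v) k"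
proof (cases "monom_degree k = 1")
  case True
  then obtain v where k: "k = Poly_Mapping.single v 1" by (rule monom_degree_eq_1)
  show ?thesis unfolding k by (simp only: weight_single lookup_Var_sum) simp
next
  case False
  then have "Poly_Mapping.lookup f k = 0" if "f \<in> homogeneous_component 1" for f :: "('v, 'k) mpoly"
    using that by (auto simp: homogeneous_component_def in_keys_iff)
  with L Var_sum_homogeneous show ?thesis by (metis mult_zero_right)
qed

text \<open>Substituting \<open>u v\<close> times \<open>v\<close> for each variable \<open>v\<close> carries the sum of the variables to
  the form with coefficients \<open>u\<close>. On matrices this is multiplication by the diagonal matrices of monomial
  weights on both sides, which are invertible when no coefficient vanishes.\<close>

lemma inj_mod_rescale:
  fixes L :: "('v::finite, 'k::field) mpoly"
  assumes up: "upclosed J" and fin: "finite (std_monomials J d)"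
    and L: "L \<in> homogeneous_component 1"
    and nz: "\<And>v. Poly_Mapping.lookup L (Poly_Mapping.single v 1) \<noteq> 0"
    and inj: "inj_mod J L d"
  shows "inj_mod J (\<Sum>v\<in>UNIV. Var v :: ('v, 'k) mpoly) d"
proof -
  let ?L0 = "\<Sum>v\<in>UNIV. Var v :: ('v, 'k) mpoly"
  define w where "w = weight (\<lambda>v. Poly_Mapping.lookup L (Poly_Mapping.single v 1))"
  have w_nz: "w m \<noteq> 0" for m unfolding w_def by (rule weight_nonzero) (rule nz)
  have entry: "mult_entry L r c * w c = w r * mult_entry ?L0 r c" for r c
  proof (cases "\<exists>k. r = k + c")
    case True
    then obtain k where k: "r = k + c" by blast
    have "Poly_Mapping.lookup L k = w k * Poly_Mapping.lookup ?L0 k"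
      unfolding w_def by (rule linear_form_rescaled[OF L])
    then show ?thesis by (simp add: k w_def weight_add)
  next
    case False
    then show ?thesis by (simp add: mult_entry_not_multiple)
  qed
  show ?thesis
    unfolding inj_mod_iff_system[OF up fin Var_sum_homogeneous] system_injective_def
  proof (intro allI impI)
    fix f assume f: "\<forall>r\<in>std_monomials J (d + 1). (\<Sum>c\<in>std_monomials J d. mult_entry ?L0 r c * f c) = 0"
    have "\<forall>r\<in>std_monomials J (d + 1). (\<Sum>c\<in>std_monomials J d. mult_entry L r c * (w c * f c)) = 0"
    proof
      fix r assume "r \<in> std_monomials J (d + 1)"
      then have "w r * (\<Sum>c\<in>std_monomials J d. mult_entry ?L0 r c * f c) = 0"
        using f by simp
      then show "(\<Sum>c\<in>std_monomials J d. mult_entry L r c * (w c * f c)) = 0"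
        by (simp only: sum_distrib_left mult.assoc[symmetric] entry)
    qed
    then have "\<forall>c\<in>std_monomials J d. w c * f c = 0"
      using inj[unfolded inj_mod_iff_system[OF up fin L] system_injective_def, rule_format, of "\<lambda>c. w c * f c"] by blast
    then show "\<forall>c\<in>std_monomials J d. f c = 0" using w_nz by simp
  qed
qed

text \<open>The form \<open>L\<close> may have vanishing coefficients, so it cannot be rescaled to the
  sum of the variables directly. It is first moved inside its pencil with that sum to a form without
  vanishing coefficients and still with a nonsingular matrix; only finitely many parameters are bad.\<close>

lemma inj_mod_sum_of_variables:
  fixes L :: "('v::finite, 'k::field) mpoly"
  assumes inf: "infinite (UNIV :: 'k set)"
    and up: "upclosed J" and L: "L \<in> homogeneous_component 1"
    and fin: "finite (std_monomials J d)" "finite (std_monomials J (d + 1))"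
    and card: "card (std_monomials J (d + 1)) = card (std_monomials J d)"
    and inj: "inj_mod J L d"
  shows "inj_mod J (\<Sum>v\<in>UNIV. Var v :: ('v, 'k) mpoly) d"
proof -
  let ?L0 = "\<Sum>v\<in>UNIV. Var v :: ('v, 'k) mpoly"
  define Lt where "Lt t = L + Poly_Mapping.single 0 t * ?L0" for t
  have t_L0: "Poly_Mapping.single 0 t * ?L0 \<in> homogeneous_component 1" for t
    using times_homogeneous[OF single_homogeneous[of 0 t] Var_sum_homogeneous]
    by (simp add: monom_degree_def)
  have Lt: "Lt t \<in> homogeneous_component 1" for t
    unfolding Lt_def by (rule add_homogeneous[OF L t_L0])
  obtain p :: "'k poly" where p: "\<forall>t.
    poly p t \<noteq> 0 \<longleftrightarrow> system_injective (std_monomials J (d + 1)) (std_monomials J d)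
      (\<lambda>r c. mult_entry L r c + t * mult_entry ?L0 r c)"
    using square_pencil_polynomial[OF fin(2,1) card, of "mult_entry L" "mult_entry ?L0"] by blast
  have p_inj: "poly p t \<noteq> 0 \<longleftrightarrow> inj_mod J (Lt t) d" for t
    unfolding inj_mod_iff_system[OF up fin(1) Lt] using p by (simp add: Lt_def mult_entry_pencil[abs_def])
  have "poly p 0 \<noteq> 0" unfolding p_inj using inj by (simp add: Lt_def)
  then have "p \<noteq> 0" by auto
  \<comment> \<open>The roots of \<open>p\<close>, and the parameters at which some coefficient of \<open>Lt t\<close> vanishes.\<close>
  let ?bad = "{t. poly p t = 0} \<union> range (\<lambda>v. - Poly_Mapping.lookup L (Poly_Mapping.single v 1))"
  have "finite ?bad" using poly_roots_finite[OF \<open>p \<noteq> 0\<close>] by simp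
  then obtain t where t: "t \<notin> ?bad" using inf ex_new_if_finite by blast
  have "Poly_Mapping.lookup (Lt t) (Poly_Mapping.single v 1) =
      Poly_Mapping.lookup L (Poly_Mapping.single v 1) + t" for v
    using mult_entry_pencil[of L t ?L0 "Poly_Mapping.single v 1" 0]
    unfolding Lt_def[symmetric] by (simp only: mult_entry_def single_one mult_1_right lookup_Var_sum)
  then have nz: "Poly_Mapping.lookup (Lt t) (Poly_Mapping.single v 1) \<noteq> 0" for v
    using t by (auto simp: add_eq_0_iff)
  have "inj_mod J (Lt t) d" using p_inj t by blast
  from inj_mod_rescale[OF up fin(1) Lt nz this] show ?thesis .
qed

section \<open>From one degree to all degrees\<close>

text \<open>A form \<open>f\<close> in the kernel that is nonzero modulo the ideal has a standard monomial
  \<open>m\<close> in its support. If \<open>m + n\<close> is still standard, then \<open>n\<close> times \<open>f\<close> is in the kernel and still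
  nonzero, as its coefficient at \<open>m + n\<close> is that of \<open>f\<close> at \<open>m\<close>.\<close>

lemma inj_mod_lower_degree:
  fixes L :: "('v, 'k::comm_ring_1) mpoly"
  assumes up: "upclosed J" and inj: "inj_mod J L e"
    and ext: "\<And>m. m \<in> std_monomials J d \<Longrightarrow> \<exists>n. m + n \<in> std_monomials J e"
  shows "inj_mod J L d"
  unfolding inj_mod_def
proof (intro ballI impI)
  fix f :: "('v, 'k) mpoly"
  assume f: "f \<in> homogeneous_component d" "L * f \<in> monomial_ideal J"
  show "f \<in> monomial_ideal J"
  proof (rule ccontr)
    assume "f \<notin> monomial_ideal J"
    then obtain m where m: "m \<in> Poly_Mapping.keys f" "m \<notin> J" by (auto simp: monomial_ideal_def)
    then have deg: "int (monom_degree m) = d" using f(1) by (simp add: homogeneous_component_def)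
    then obtain n where n: "m + n \<in> std_monomials J e" using ext m by (auto simp: std_monomials_def)
    let ?g = "f * Poly_Mapping.single n 1"
    have "?g \<in> homogeneous_component e"
      using times_homogeneous[OF f(1) single_homogeneous[of n 1]] n deg
      by (simp add: std_monomials_def monom_degree_add)
    moreover have "L * ?g \<in> monomial_ideal J"
      using monomial_ideal_times[OF up f(2), of "Poly_Mapping.single n 1"] by (simp add: ac_simps)
    ultimately have "?g \<in> monomial_ideal J" using inj by (simp add: inj_mod_def)
    moreover have "Poly_Mapping.lookup ?g (m + n) \<noteq> 0"
      using m(1) by (simp add: lookup_times_single in_keys_iff)
    ultimately have "m + n \<in> J" by (auto simp: monomial_ideal_def in_keys_iff)
    with n show False by (simp add: std_monomials_def)
  qed
qed

text \<open>A monomial of degree \<open>d + 2\<close> is a variable times a monomial of degree \<open>d + 1\<close>,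
  and preimages can be multiplied by variables. The degree bound ensures that there is a variable to
  split off.\<close>

lemma surj_mod_Suc:
  fixes L :: "('v, 'k::comm_ring_1) mpoly"
  assumes up: "upclosed J" and surj: "surj_mod J L d" and d: "d \<ge> - 1"
  shows "surj_mod J L (d + 1)"
  unfolding surj_mod_def
proof
  fix g :: "('v, 'k) mpoly" assume g: "g \<in> homogeneous_component (d + 1 + 1)"
  have mono: "\<exists>f\<in>homogeneous_component (d + 1). L * f - Poly_Mapping.single m c \<in> monomial_ideal J"
    if m: "int (monom_degree m) = d + 1 + 1" for m and c :: 'k
  proof -
    obtain v m' where m': "m = Poly_Mapping.single v 1 + m'" "monom_degree m = Suc (monom_degree m')"
      using monomial_factor_variable[of m] m d by auto
    then have "Poly_Mapping.single m' c \<in> homogeneous_component (d + 1)"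
      using m single_homogeneous[of m' c] by (simp add: add.commute)
    then obtain f where f: "f \<in> homogeneous_component d"
        "L * f - Poly_Mapping.single m' c \<in> monomial_ideal J"
      using surj by (auto simp: surj_mod_def)
    have "f * Var v \<in> homogeneous_component (d + 1)"
      by (rule times_homogeneous[OF f(1)]) (simp add: Var_def homogeneous_component_def)
    moreover have "L * (f * Var v) - Poly_Mapping.single m c = Var v * (L * f - Poly_Mapping.single m' c)"
      by (simp add: Var_def m'(1) right_diff_distrib mult_single ac_simps)
    ultimately show ?thesis using monomial_ideal_times[OF up f(2), of "Var v"]
      by (intro bexI[of _ "f * Var v"]) (simp_all only:)
  qed
  have "\<exists>f\<in>homogeneous_component (d + 1).
      L * f - (\<Sum>m\<in>T. Poly_Mapping.single m (Poly_Mapping.lookup g m)) \<in> monomial_ideal J"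
    if "finite T" "T \<subseteq> Poly_Mapping.keys g" for T
    using that
  proof (induction T rule: finite_induct)
    case empty
    show ?case by (intro bexI[of _ 0]) (simp_all add: zero_homogeneous monomial_ideal_def)
  next
    case (insert m T)
    let ?S = "\<Sum>m\<in>T. Poly_Mapping.single m (Poly_Mapping.lookup g m)"
    let ?s = "Poly_Mapping.single m (Poly_Mapping.lookup g m)"
    obtain f1 where f1: "f1 \<in> homogeneous_component (d + 1)" "L * f1 - ?S \<in> monomial_ideal J"
      using insert by auto
    obtain f2 where f2: "f2 \<in> homogeneous_component (d + 1)" "L * f2 - ?s \<in> monomial_ideal J"
      using mono[of m "Poly_Mapping.lookup g m"] g insert.prems
      by (auto simp: homogeneous_component_def)
    have "L * (f1 + f2) - (?s + ?S) = (L * f1 - ?S) + (L * f2 - ?s)"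
      by (simp add: algebra_simps)
    then have "L * (f1 + f2) - (?s + ?S) \<in> monomial_ideal J"
      using monomial_ideal_add[OF f1(2) f2(2)] by (simp only:)
    then show ?case using add_homogeneous[OF f1(1) f2(1)] insert.hyps by auto
  qed
  from this[of "Poly_Mapping.keys g"]
  show "\<exists>f\<in>homogeneous_component (d + 1). L * f - g \<in> monomial_ideal J"
    using poly_mapping_sum_singles[of g] by simp
qed

section \<open>Counting standard monomials in three variables\<close>

lemma UNIV_xyz: "UNIV = {Vx, Vy, Vz}"
  by (auto intro: xyz.exhaust)

instance xyz :: finite
  by standard (simp add: UNIV_xyz)

definition xyz_monom :: "nat \<Rightarrow> nat \<Rightarrow> nat \<Rightarrow> xyz \<Rightarrow>\<^sub>0 nat" where
  "xyz_monom i j k = Poly_Mapping.single Vx i + Poly_Mapping.single Vy j + Poly_Mapping.single Vz k"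

lemma lookup_xyz_monom [simp]:
  "Poly_Mapping.lookup (xyz_monom i j k) Vx = i"
  "Poly_Mapping.lookup (xyz_monom i j k) Vy = j"
  "Poly_Mapping.lookup (xyz_monom i j k) Vz = k"
  by (simp_all add: xyz_monom_def lookup_add lookup_single when_def)

lemma xyz_monom_eqI:
  assumes "Poly_Mapping.lookup m Vx = Poly_Mapping.lookup n Vx"
    "Poly_Mapping.lookup m Vy = Poly_Mapping.lookup n Vy"
    "Poly_Mapping.lookup m Vz = Poly_Mapping.lookup n Vz"
  shows "m = n"
  by (rule poly_mapping_eqI) (metis assms xyz.exhaust)

lemma xyz_monom_lookup: "xyz_monom (Poly_Mapping.lookup m Vx) (Poly_Mapping.lookup m Vy) (Poly_Mapping.lookup m Vz) = m"
  by (rule xyz_monom_eqI) simp_all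

lemma monom_degree_xyz:
  "monom_degree m = Poly_Mapping.lookup m Vx + Poly_Mapping.lookup m Vy + Poly_Mapping.lookup m Vz"
  using monom_degree_superset[OF finite subset_UNIV, of m] by (simp add: UNIV_xyz)

lemma multiples_iff_le:
  "m \<in> multiples {g} \<longleftrightarrow> (\<forall>v. Poly_Mapping.lookup g v \<le> Poly_Mapping.lookup m v)"
proof
  assume "\<forall>v. Poly_Mapping.lookup g v \<le> Poly_Mapping.lookup m v"
  then have "m = g + (m - g)"
    by (intro poly_mapping_eqI) (simp add: lookup_add lookup_minus)
  then show "m \<in> multiples {g}" by (auto simp: multiples_def)
qed (auto simp: multiples_def lookup_add)

lemma multiples_xyz_monom_iff:
  "m \<in> multiples {xyz_monom i j k} \<longleftrightarrow> i \<le> Poly_Mapping.lookup m Vx \<and>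
     j \<le> Poly_Mapping.lookup m Vy \<and> k \<le> Poly_Mapping.lookup m Vz"
  unfolding multiples_iff_le by (metis lookup_xyz_monom xyz.exhaust)

lemma multiples_Un: "multiples G = (\<Union>g\<in>G. multiples {g})"
  by (auto simp: multiples_def)

lemma finite_std_monomials_xyz: "finite (std_monomials J d :: (xyz \<Rightarrow>\<^sub>0 nat) set)"
proof (rule finite_subset)
  show "std_monomials J d \<subseteq> (\<lambda>(i, j, k). xyz_monom i j k) ` ({..nat d} \<times> {..nat d} \<times> {..nat d})"
  proof
    fix m :: "xyz \<Rightarrow>\<^sub>0 nat" assume "m \<in> std_monomials J d"
    then have "(Poly_Mapping.lookup m Vx, Poly_Mapping.lookup m Vy, Poly_Mapping.lookup m Vz)
        \<in> {..nat d} \<times> {..nat d} \<times> {..nat d}"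
      by (auto simp: std_monomials_def monom_degree_xyz)
    then show "m \<in> (\<lambda>(i, j, k). xyz_monom i j k) ` ({..nat d} \<times> {..nat d} \<times> {..nat d})"
      by (rule rev_image_eqI) (simp add: xyz_monom_lookup)
  qed
qed simp

text \<open>Multiplication by \<open>x\<close> is injective, and the \<open>e + 2\<close> monomials of degree \<open>e + 1\<close> in
  \<open>y\<close> and \<open>z\<close> alone are what it misses. Allowing \<open>e = - 2\<close>, where both sides are zero, is what makes
  the step usable for generators of degree up to \<open>s + 2\<close>.\<close>

lemma card_monomials_step:
  assumes "e \<ge> - 2"
  shows "int (card (std_monomials {} (e + 1) :: (xyz \<Rightarrow>\<^sub>0 nat) set)) =
    int (card (std_monomials {} e :: (xyz \<Rightarrow>\<^sub>0 nat) set)) + (e + 2)"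
proof -
  let ?X = "(\<lambda>m. Poly_Mapping.single Vx 1 + m) ` std_monomials {} e"
  let ?Y = "(\<lambda>j. xyz_monom 0 j (nat (e + 1) - j)) ` {..<nat (e + 2)}"
  have "std_monomials {} (e + 1) = ?X \<union> ?Y"
  proof (intro equalityI subsetI)
    fix m :: "xyz \<Rightarrow>\<^sub>0 nat" assume m: "m \<in> std_monomials {} (e + 1)"
    show "m \<in> ?X \<union> ?Y"
    proof (cases "Poly_Mapping.lookup m Vx = 0")
      case True
      then have "m = xyz_monom 0 (Poly_Mapping.lookup m Vy) (nat (e + 1) - Poly_Mapping.lookup m Vy)"
        using m by (intro xyz_monom_eqI) (auto simp: std_monomials_def monom_degree_xyz)
      moreover have "Poly_Mapping.lookup m Vy < nat (e + 2)"
        using m by (auto simp: std_monomials_def monom_degree_xyz)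
      ultimately show ?thesis by blast
    next
      case False
      then have eq: "m = Poly_Mapping.single Vx 1 + (m - Poly_Mapping.single Vx 1)"
        by (intro xyz_monom_eqI) (auto simp: lookup_add lookup_minus lookup_single when_def)
      have "monom_degree m = 1 + monom_degree (m - Poly_Mapping.single Vx 1)"
        by (subst eq) (simp only: monom_degree_add monom_degree_single)
      then have "m - Poly_Mapping.single Vx 1 \<in> std_monomials {} e"
        using m by (simp add: std_monomials_def)
      then show ?thesis using eq by blast
    qed
  next
    fix m :: "xyz \<Rightarrow>\<^sub>0 nat" assume "m \<in> ?X \<union> ?Y"
    then show "m \<in> std_monomials {} (e + 1)"
      using assms
      by (auto simp: std_monomials_def monom_degree_add) (simp add: monom_degree_xyz)
  qed
  moreover have "?X \<inter> ?Y = {}"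
  proof -
    have "Poly_Mapping.single Vx 1 + m \<noteq> xyz_monom 0 j k" for m j k
      by (metis lookup_add lookup_xyz_monom(1) lookup_single_eq add_is_0 zero_neq_one)
    then show ?thesis by blast
  qed
  moreover have "card ?X = card (std_monomials {} e :: (xyz \<Rightarrow>\<^sub>0 nat) set)"
    by (rule card_image) (auto intro: inj_onI)
  moreover have "card ?Y = nat (e + 2)"
    by (subst card_image) (auto intro!: inj_onI dest: arg_cong[of _ _ "\<lambda>m. Poly_Mapping.lookup m Vy"])
  moreover have "finite ?X" "finite ?Y" by (simp_all add: finite_std_monomials_xyz)
  ultimately show ?thesis using assms by (simp add: card_Un_disjoint)
qed

text \<open>Inclusion-exclusion stops after the first step in degrees below those of all
  pairwise least common multiples.\<close>

lemma card_std_monomials_multiples: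
  fixes G :: "(xyz \<Rightarrow>\<^sub>0 nat) set"
  assumes fin: "finite G"
    and lcm: "\<And>g h m. g \<in> G \<Longrightarrow> h \<in> G \<Longrightarrow> g \<noteq> h \<Longrightarrow> m \<in> multiples {g} \<Longrightarrow> m \<in> multiples {h} \<Longrightarrow>
      int (monom_degree m) > e"
  shows "int (card (std_monomials (multiples G) e)) = int (card (std_monomials {} e :: (xyz \<Rightarrow>\<^sub>0 nat) set)) -
    (\<Sum>g\<in>G. int (card (std_monomials {} (e - int (monom_degree g)) :: (xyz \<Rightarrow>\<^sub>0 nat) set)))"
proof -
  define D where "D g = (\<lambda>n. g + n) ` std_monomials {} (e - int (monom_degree g))" for g :: "xyz \<Rightarrow>\<^sub>0 nat"
  have D: "D g = {m \<in> multiples {g}. int (monom_degree m) = e}" for g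
  proof (intro equalityI subsetI)
    fix m assume "m \<in> {m \<in> multiples {g}. int (monom_degree m) = e}"
    then show "m \<in> D g"
      by (auto simp: D_def multiples_def std_monomials_def monom_degree_add)
  qed (auto simp: D_def multiples_def std_monomials_def monom_degree_add)
  have fin_D: "finite (D g)" for g unfolding D_def by (simp add: finite_std_monomials_xyz)
  have "card (D g) = card (std_monomials {} (e - int (monom_degree g)) :: (xyz \<Rightarrow>\<^sub>0 nat) set)" for g
    unfolding D_def by (rule card_image) (auto intro: inj_onI)
  moreover have "card (\<Union>g\<in>G. D g) = (\<Sum>g\<in>G. card (D g))"
    using lcm by (intro card_UN_disjoint fin) (auto simp: fin_D, auto simp: D)
  moreover have "std_monomials (multiples G) e = std_monomials {} e - (\<Union>g\<in>G. D g)"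
    unfolding multiples_Un[of G] D by (auto simp: std_monomials_def)
  moreover have "(\<Union>g\<in>G. D g) \<subseteq> std_monomials {} e"
    by (auto simp: D std_monomials_def)
  ultimately show ?thesis
    using card_mono[OF finite_std_monomials_xyz \<open>(\<Union>g\<in>G. D g) \<subseteq> std_monomials {} e\<close>]
    by (simp add: card_Diff_subset fin fin_D of_nat_diff)
qed

text \<open>The Hilbert function grows from \<open>s\<close> to \<open>s + 1\<close> by \<open>s + 2\<close> for the polynomial ring, and
  each generator of degree \<open>e\<close> takes away a growth of \<open>s + 2 - e\<close>.\<close>

lemma card_std_monomials_balanced:
  fixes G :: "(xyz \<Rightarrow>\<^sub>0 nat) set"
  assumes fin: "finite G" and s: "s \<ge> - 2"
    and lcm: "\<And>g h m. g \<in> G \<Longrightarrow> h \<in> G \<Longrightarrow> g \<noteq> h \<Longrightarrow> m \<in> multiples {g} \<Longrightarrow> m \<in> multiples {h} \<Longrightarrow>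
      int (monom_degree m) > s + 1"
    and deg: "\<And>g. g \<in> G \<Longrightarrow> int (monom_degree g) \<le> s + 2"
    and bal: "(\<Sum>g\<in>G. s + 2 - int (monom_degree g)) = s + 2"
  shows "card (std_monomials (multiples G) (s + 1)) = card (std_monomials (multiples G) s)"
proof -
  let ?h = "\<lambda>e. int (card (std_monomials {} e :: (xyz \<Rightarrow>\<^sub>0 nat) set))"
  have "int (card (std_monomials (multiples G) (s + 1))) =
      ?h (s + 1) - (\<Sum>g\<in>G. ?h (s + 1 - int (monom_degree g)))"
    using lcm by (intro card_std_monomials_multiples fin)
  also have "(\<Sum>g\<in>G. ?h (s + 1 - int (monom_degree g))) =
      (\<Sum>g\<in>G. ?h (s - int (monom_degree g)) + (s + 2 - int (monom_degree g)))"
  proof (rule sum.cong)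
    fix g assume "g \<in> G"
    then show "?h (s + 1 - int (monom_degree g)) =
        ?h (s - int (monom_degree g)) + (s + 2 - int (monom_degree g))"
      using card_monomials_step[of "s - int (monom_degree g)"] deg[of g] by (simp add: algebra_simps)
  qed simp
  also have "\<dots> = (\<Sum>g\<in>G. ?h (s - int (monom_degree g))) + (s + 2)"
    by (simp only: sum.distrib bal)
  also have "?h (s + 1) = ?h s + (s + 2)" using s by (rule card_monomials_step)
  also have "?h s + (s + 2) - ((\<Sum>g\<in>G. ?h (s - int (monom_degree g))) + (s + 2)) =
      int (card (std_monomials (multiples G) s))"
    using card_std_monomials_multiples[OF fin, of s] lcm by force
  finally show ?thesis by simp
qed

lemma Var_power: "(Var v :: ('v, 'k::comm_ring_1) mpoly) ^ n = Poly_Mapping.single (Poly_Mapping.single v n) 1"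
  by (induction n) (simp_all add: Var_def mult_single single_add[symmetric])

section \<open>The ideal of a monomial almost complete intersection\<close>

lemma box_point:
  fixes i j k p q r n :: nat
  assumes "i \<le> p" "j \<le> q" "k \<le> r" "i + j + k \<le> n" "n \<le> p + q + r"
  obtains i' j' k' where "i \<le> i'" "i' \<le> p" "j \<le> j'" "j' \<le> q" "k \<le> k'" "k' \<le> r" "i' + j' + k' = n"
proof -
  consider "n \<le> p + j + k" | "p + j + k < n" "n \<le> p + q + k" | "p + q + k < n" by linarith
  then show ?thesis
  proof cases
    case 1
    then show ?thesis using assms by (intro that[of "n - j - k" j k]) linarith+
  next
    case 2
    then show ?thesis using assms by (intro that[of p "n - p - k" k]) linarith+
  next
    case 3
    then show ?thesis using assms by (intro that[of p q "n - p - q"]) linarith+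
  qed
qed

definition aci_generators :: "nat \<Rightarrow> nat \<Rightarrow> nat \<Rightarrow> nat \<Rightarrow> nat \<Rightarrow> nat \<Rightarrow> (xyz \<Rightarrow>\<^sub>0 nat) set" where
  "aci_generators a b c \<alpha> \<beta> \<gamma> = {xyz_monom a 0 0, xyz_monom 0 b 0, xyz_monom 0 0 c, xyz_monom \<alpha> \<beta> \<gamma>}"

lemma aci_ideal:
  "Idl\<^bsub>mpoly_ring\<^esub> {Var Vx ^ a, Var Vy ^ b, Var Vz ^ c, Var Vx ^ \<alpha> * Var Vy ^ \<beta> * Var Vz ^ \<gamma>} =
     (monomial_ideal (multiples (aci_generators a b c \<alpha> \<beta> \<gamma>)) :: (xyz, 'k::comm_ring_1) mpoly set)"
  unfolding genideal_monomials[symmetric]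
  by (simp add: aci_generators_def Var_power mult_single xyz_monom_def)

lemma not_in_aci_iff:
  "m \<notin> multiples (aci_generators a b c \<alpha> \<beta> \<gamma>) \<longleftrightarrow>
     Poly_Mapping.lookup m Vx < a \<and> Poly_Mapping.lookup m Vy < b \<and> Poly_Mapping.lookup m Vz < c \<and>
     (Poly_Mapping.lookup m Vx < \<alpha> \<or> Poly_Mapping.lookup m Vy < \<beta> \<or> Poly_Mapping.lookup m Vz < \<gamma>)"
  unfolding multiples_Un[of "aci_generators a b c \<alpha> \<beta> \<gamma>"]
  by (auto simp: aci_generators_def multiples_xyz_monom_iff)

text \<open>Each exponent of a monomial outside the ideal is below that of the pure power,
  and some exponent is below that of the mixed generator. Keeping that one exponent small, the
  largest such box has its top corner in one of the degrees \<open>\<alpha> + b + c - 3\<close>, \<open>a + \<beta> + c - 3\<close>,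
  \<open>a + b + \<gamma> - 3\<close>; where the exponent in question is
  positive, these are the socle degrees of the quotient, and they are assumed to be at least \<open>s\<close>.\<close>

lemma aci_standard_extends:
  assumes m: "m \<in> std_monomials (multiples (aci_generators a b c \<alpha> \<beta> \<gamma>)) d" and "d \<le> s"
    and "\<alpha> < a" "\<beta> < b" "\<gamma> < c"
    and socle: "\<alpha> > 0 \<Longrightarrow> s + 3 \<le> int (\<alpha> + b + c)" "\<beta> > 0 \<Longrightarrow> s + 3 \<le> int (a + \<beta> + c)"
      "\<gamma> > 0 \<Longrightarrow> s + 3 \<le> int (a + b + \<gamma>)"
  shows "\<exists>n. m + n \<in> std_monomials (multiples (aci_generators a b c \<alpha> \<beta> \<gamma>)) s"
proof -
  define i j k where ijk: "i = Poly_Mapping.lookup m Vx" "j = Poly_Mapping.lookup m Vy" "k = Poly_Mapping.lookup m Vz"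
  have m': "i < a" "j < b" "k < c" "i < \<alpha> \<or> j < \<beta> \<or> k < \<gamma>" "int (i + j + k) = d"
    using m by (simp_all add: std_monomials_def not_in_aci_iff monom_degree_xyz ijk)
  obtain p q r where pqr: "i \<le> p" "p < a" "j \<le> q" "q < b" "k \<le> r" "r < c"
      "p < \<alpha> \<or> q < \<beta> \<or> r < \<gamma>" "s \<le> int (p + q + r)"
  proof -
    consider "i < \<alpha>" | "j < \<beta>" | "k < \<gamma>" using m'(4) by blast
    then show ?thesis
    proof cases
      case 1
      then show ?thesis using m' assms by (intro that[of "\<alpha> - 1" "b - 1" "c - 1"]) auto
    next
      case 2
      then show ?thesis using m' assms by (intro that[of "a - 1" "\<beta> - 1" "c - 1"]) auto
    next
      case 3
      then show ?thesis using m' assms by (intro that[of "a - 1" "b - 1" "\<gamma> - 1"]) auto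
    qed
  qed
  have "i + j + k \<le> nat s" "nat s \<le> p + q + r" using m'(5) \<open>d \<le> s\<close> pqr(8) by linarith+
  then obtain i' j' k' where new: "i \<le> i'" "i' \<le> p" "j \<le> j'" "j' \<le> q" "k \<le> k'" "k' \<le> r" "i' + j' + k' = nat s"
    using box_point[OF pqr(1,3,5)] by blast
  have "s \<ge> 0" using m'(5) \<open>d \<le> s\<close> by linarith
  have "m + xyz_monom (i' - i) (j' - j) (k' - k) = xyz_monom i' j' k'"
    using new by (intro xyz_monom_eqI) (simp_all add: lookup_add ijk)
  moreover have "xyz_monom i' j' k' \<in> std_monomials (multiples (aci_generators a b c \<alpha> \<beta> \<gamma>)) s"
    using new pqr \<open>s \<ge> 0\<close> by (auto simp: std_monomials_def not_in_aci_iff monom_degree_xyz)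
  ultimately show ?thesis by metis
qed

text \<open>The bounds by \<open>s + 2\<close> on the lcm degrees of two pure powers, such as \<open>a + b\<close>,
  follow from the value of the total degree and from \<open>c\<close> and \<open>\<alpha> + \<beta> + \<gamma>\<close> being at most
  \<open>s + 2\<close>.\<close>

lemma card_std_monomials_aci:
  assumes "\<alpha> < a" "\<beta> < b" "\<gamma> < c"
    and s: "int (a + b + c + \<alpha> + \<beta> + \<gamma>) = 3 * s + 6"
    and "int a \<le> s + 2" "int b \<le> s + 2" "int c \<le> s + 2" "int (\<alpha> + \<beta> + \<gamma>) \<le> s + 2"
    and "s + 2 \<le> int (a + \<beta> + \<gamma>)" "s + 2 \<le> int (\<alpha> + b + \<gamma>)" "s + 2 \<le> int (\<alpha> + \<beta> + c)"
  defines "J \<equiv> multiples (aci_generators a b c \<alpha> \<beta> \<gamma>)"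
  shows "card (std_monomials J (s + 1)) = card (std_monomials J s)"
  unfolding J_def
proof (rule card_std_monomials_balanced)
  let ?G = "aci_generators a b c \<alpha> \<beta> \<gamma>"
  show "finite ?G" by (simp add: aci_generators_def)
  show "s \<ge> - 2" using assms(5) by linarith
  show "int (monom_degree g) \<le> s + 2" if "g \<in> ?G" for g
    using that assms by (auto simp: aci_generators_def monom_degree_xyz)
  show "int (monom_degree m) > s + 1"
    if "g \<in> ?G" "h \<in> ?G" "g \<noteq> h" "m \<in> multiples {g}" "m \<in> multiples {h}" for g h m
  proof -
    have "s + 2 \<le> int a + int b" "s + 2 \<le> int a + int c" "s + 2 \<le> int b + int c"
      "s + 2 \<le> int a + int \<beta> + int \<gamma>" "s + 2 \<le> int \<alpha> + int b + int \<gamma>"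
      "s + 2 \<le> int \<alpha> + int \<beta> + int c"
      using assms(4-11) unfolding of_nat_add by linarith+
    then show ?thesis
      using that unfolding aci_generators_def
      by (auto simp: multiples_xyz_monom_iff monom_degree_xyz)
  qed
  have "xyz_monom i j k = xyz_monom i' j' k' \<longleftrightarrow> i = i' \<and> j = j' \<and> k = k'" for i j k i' j' k'
    by (metis lookup_xyz_monom)
  then show "(\<Sum>g\<in>?G. s + 2 - int (monom_degree g)) = s + 2"
    using assms by (simp add: aci_generators_def monom_degree_xyz)
qed

lemma Var_sum_xyz: "(\<Sum>v\<in>UNIV. Var v) = (Var Vx + Var Vy + Var Vz :: (xyz, 'k::comm_ring_1) mpoly)"
  by (simp add: UNIV_xyz add.assoc)

theorem corollary3p7:
  fixes a b c \<alpha> \<beta> \<gamma> :: nat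
    and s A B C M :: int
    and I :: "(xyz, 'k::field) mpoly set"
    and l :: "(xyz, 'k) mpoly set"
  assumes "infinite (UNIV :: 'k set)"
    and "\<alpha> < a" and "\<beta> < b" and "\<gamma> < c"
    and "\<not> (\<alpha> = 0 \<and> \<beta> = 0)" and "\<not> (\<alpha> = 0 \<and> \<gamma> = 0)" and "\<not> (\<beta> = 0 \<and> \<gamma> = 0)"
    and "I = Idl\<^bsub>mpoly_ring\<^esub> {Var Vx ^ a, Var Vy ^ b, Var Vz ^ c, Var Vx ^ \<alpha> * Var Vy ^ \<beta> * Var Vz ^ \<gamma>}"
    and "l = I +>\<^bsub>mpoly_ring\<^esub> (Var Vx + Var Vy + Var Vz)"
    and "3 dvd (a + b + c + \<alpha> + \<beta> + \<gamma>)"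
    and "s = int ((a + b + c + \<alpha> + \<beta> + \<gamma>) div 3) - 2"
    and "A = s + 2 - int a"
    and "B = s + 2 - int b"
    and "C = s + 2 - int c"
    and "M = s + 2 - int (\<alpha> + \<beta> + \<gamma>)"
    and "0 \<le> M"
    and "0 \<le> A" and "A \<le> int (\<beta> + \<gamma>)"
    and "0 \<le> B" and "B \<le> int (\<alpha> + \<gamma>)"
    and "0 \<le> C" and "C \<le> int (\<alpha> + \<beta>)"
  shows "(weak_Lefschetz I \<longleftrightarrow> mult_injective I l s) \<and>
         (weak_Lefschetz I \<longleftrightarrow> mult_surjective I l s)"
proof -
  define J where "J = multiples (aci_generators a b c \<alpha> \<beta> \<gamma>)"
  let ?L = "Var Vx + Var Vy + Var Vz :: (xyz, 'k) mpoly"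
  have up: "upclosed J" unfolding J_def by (rule upclosed_multiples)
  have I: "I = monomial_ideal J" unfolding assms(8) J_def by (rule aci_ideal)
  have L: "?L \<in> homogeneous_component 1"
    unfolding Var_sum_xyz[symmetric] by (rule Var_sum_homogeneous)
  have fin: "finite (std_monomials J d)" for d by (rule finite_std_monomials_xyz)
  have s3: "int (a + b + c + \<alpha> + \<beta> + \<gamma>) = 3 * s + 6"
    using assms(10,11) by auto
  have bal: "card (std_monomials J (s + 1)) = card (std_monomials J s)"
    unfolding J_def using s3 assms(2-4,12-22) by (intro card_std_monomials_aci) linarith+
  have s0: "s \<ge> - 1" using assms(2,12,17) by linarith
  have inj_iff: "mult_injective I (I +>\<^bsub>mpoly_ring\<^esub> L') d \<longleftrightarrow> inj_mod J L' d" for L' :: "(xyz, 'k) mpoly" and d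
    unfolding I by (rule mult_injective_iff[OF up])
  have surj_iff: "mult_surjective I (I +>\<^bsub>mpoly_ring\<^esub> L') d \<longleftrightarrow> surj_mod J L' d"
    if "L' \<in> homogeneous_component 1" for L' :: "(xyz, 'k) mpoly" and d
    unfolding I by (rule mult_surjective_iff[OF up that])
  have inj_surj: "inj_mod J L' s \<longleftrightarrow> surj_mod J L' s" if "L' \<in> homogeneous_component 1" for L' :: "(xyz, 'k) mpoly"
    by (rule inj_mod_iff_surj_mod[OF up that fin fin bal])
  have "weak_Lefschetz I \<longleftrightarrow> inj_mod J ?L s"
  proof
    assume "weak_Lefschetz I"
    then obtain L' :: "(xyz, 'k) mpoly" where L': "L' \<in> homogeneous_component 1"
        "mult_injective I (I +>\<^bsub>mpoly_ring\<^esub> L') s \<or> mult_surjective I (I +>\<^bsub>mpoly_ring\<^esub> L') s"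
      unfolding weak_Lefschetz_def quotient_component_def by blast
    then have "inj_mod J L' s" using inj_iff surj_iff inj_surj by blast
    from inj_mod_sum_of_variables[OF assms(1) up L'(1) fin fin bal this]
    show "inj_mod J ?L s" unfolding Var_sum_xyz .
  next
    assume inj: "inj_mod J ?L s"
    have low: "inj_mod J ?L d" if "d \<le> s" for d
    proof (rule inj_mod_lower_degree[OF up inj])
      fix m assume "m \<in> std_monomials J d"
      then show "\<exists>n. m + n \<in> std_monomials J s"
        unfolding J_def by (rule aci_standard_extends) (use that s3 assms(2-4,12-22) in linarith)+
    qed
    have high: "surj_mod J ?L d" if "s \<le> d" for d
      using that
    proof (induction d rule: int_ge_induct)
      case base
      then show ?case using inj inj_surj[OF L] by simp
    next
      case (step d)
      then show ?case using s0 by (intro surj_mod_Suc[OF up]) simp_all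
    qed
    show "weak_Lefschetz I"
      unfolding weak_Lefschetz_def
    proof (intro bexI[of _ "I +>\<^bsub>mpoly_ring\<^esub> ?L"] allI)
      show "mult_injective I (I +>\<^bsub>mpoly_ring\<^esub> ?L) d \<or> mult_surjective I (I +>\<^bsub>mpoly_ring\<^esub> ?L) d" for d
        unfolding inj_iff surj_iff[OF L] using low[of d] high[of d] by linarith
      show "I +>\<^bsub>mpoly_ring\<^esub> ?L \<in> quotient_component I 1"
        unfolding quotient_component_def using L by blast
    qed
  qed
  then show ?thesis
    unfolding assms(9) inj_iff surj_iff[OF L] using inj_surj[OF L] by blast
qed

end
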